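(* For a real number $c\in(-1,1)\setminus\{0\}$ let $A_c^{+}$ and $A_c^{-}$ be the two-dimensional real algebras defined in the context. Then: (1) $A_{c}^{+}$ is isomorphic to $A_{-c}^{-}$ for every $c\in(-1,1)\setminus\{0\}$. (2) $A_{c_1}^{+}$ is not isomorphic to $A_{c_2}^{+}$ for any $c_1,c_2\in(0,1)$ with $c_1\neq c_2$. (3) $A_{c_1}^{-}$ is not isomorphic to $A_{c_2}^{-}$ for any $c_1,c_2\in(0,1)$ with $c_1\neq c_2$. (4) $A_{c_1}^{+}$ is not isomorphic to $A_{c_2}^{-}$ for any $c_1,c_2\in(0,1)$.
   Context: All algebras are over $\mathbb{R}$; an algebra is a real vector space with a bilinear product (not assumed associative, commutative or unital), and an isomorphism is a linear bijection preserving products. For $c\in(-1,1)\setminus\{0\}$ and a sign $\varepsilon\in\{+1,-1\}$ put $\sigma=\varepsilon\sqrt{1-c^2}$. The algebra $A_c^{+}$ (for $\varepsilon=+1$), respectively $A_c^{-}$ (for $\varepsilon=-1$), is the two-dimensional algebra with basis $e_1,e_2$ and products $$e_1e_1=c\,e_1+\sigma e_2,\quad e_1e_2=c\,e_1-\sigma e_2,\quad e_2e_1=-\sigma e_1+c\,e_2,\quad e_2e_2=\sigma e_1+c\,e_2 .$$ (In the notation $A_{\cos t}^{\pm}$, the parameter is $c=\cos t$.) *)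

theory Defs
  imports "HOL-Analysis.Analysis"
begin

text \<open>A real algebra is a real vector space together with a bilinear product
  \<open>m\<close>, with no further axioms; it is represented by \<open>m\<close>.\<close>

definition algebra_isomorphism ::
    "('a::real_vector \<Rightarrow> 'a \<Rightarrow> 'a) \<Rightarrow> ('b::real_vector \<Rightarrow> 'b \<Rightarrow> 'b) \<Rightarrow> ('a \<Rightarrow> 'b) \<Rightarrow> bool" where
  "algebra_isomorphism m n f \<longleftrightarrow>
     linear f \<and> bij f \<and> (\<forall>x y. f (m x y) = n (f x) (f y))"

definition algebra_isomorphic ::
    "('a::real_vector \<Rightarrow> 'a \<Rightarrow> 'a) \<Rightarrow> ('b::real_vector \<Rightarrow> 'b \<Rightarrow> 'b) \<Rightarrow> bool" where
  "algebra_isomorphic m n \<longleftrightarrow> (\<exists>f. algebra_isomorphism m n f)"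

definition e1 :: "real^2" where "e1 = axis 1 1"
definition e2 :: "real^2" where "e2 = axis 2 1"

text \<open>The bilinear extension to \<open>real^2\<close> of the multiplication table of the basis
  \<open>e1\<close>, \<open>e2\<close>, with \<open>s\<close> in the role of \<open>\<sigma>\<close>.\<close>

definition table_mult :: "real \<Rightarrow> real \<Rightarrow> real^2 \<Rightarrow> real^2 \<Rightarrow> real^2" where
  "table_mult c s x y =
     (x$1 * y$1) *\<^sub>R (c *\<^sub>R e1 + s *\<^sub>R e2) +
     (x$1 * y$2) *\<^sub>R (c *\<^sub>R e1 - s *\<^sub>R e2) +
     (x$2 * y$1) *\<^sub>R (- s *\<^sub>R e1 + c *\<^sub>R e2) +
     (x$2 * y$2) *\<^sub>R (s *\<^sub>R e1 + c *\<^sub>R e2)"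

definition A_plus :: "real \<Rightarrow> real^2 \<Rightarrow> real^2 \<Rightarrow> real^2" where
  "A_plus c = table_mult c (sqrt (1 - c\<^sup>2))"

definition A_minus :: "real \<Rightarrow> real^2 \<Rightarrow> real^2 \<Rightarrow> real^2" where
  "A_minus c = table_mult c (- sqrt (1 - c\<^sup>2))"

lemma table_mult_basis:
  "table_mult c s e1 e1 = c *\<^sub>R e1 + s *\<^sub>R e2"
  "table_mult c s e1 e2 = c *\<^sub>R e1 - s *\<^sub>R e2"
  "table_mult c s e2 e1 = - s *\<^sub>R e1 + c *\<^sub>R e2"
  "table_mult c s e2 e2 = s *\<^sub>R e1 + c *\<^sub>R e2"
  by (simp_all add: table_mult_def e1_def e2_def axis_def)

lemma bilinear_table_mult: "bilinear (table_mult c s)"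
  unfolding bilinear_def
  by (intro conjI allI linearI)
     (simp_all add: table_mult_def e1_def e2_def axis_def vec_eq_iff forall_2 algebra_simps)

lemma bilinear_A_plus: "bilinear (A_plus c)"
  and bilinear_A_minus: "bilinear (A_minus c)"
  by (simp_all add: A_plus_def A_minus_def bilinear_table_mult)

end

theory Submission
  imports Defs
begin

text \<open>The product with parameters \<open>- c\<close>, \<open>- s\<close> is the negative of the product with parameters
  \<open>c\<close>, \<open>s\<close>, so negation is an isomorphism between the two algebras; this gives (1).

  An isomorphism intertwines left and right multiplications, hence preserves the determinant
  \<open>- 2 c s (x\<^sub>1\<^sup>2 + x\<^sub>2\<^sup>2)\<close> of left multiplication by \<open>x\<close>, and the trace \<open>2 c (x\<^sub>1 + x\<^sub>2)\<close> and
  determinant \<open>c\<^sup>2 (x\<^sub>1 + x\<^sub>2)\<^sup>2 + s\<^sup>2 (x\<^sub>1 - x\<^sub>2)\<^sup>2\<close> of right multiplication by \<open>x\<close>. Comparing these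
  at \<open>x = (1, 1)\<close> shows that \<open>(c, s)\<close> is determined up to a common sign.\<close>

text \<open>The matrix of \<open>f\<close> is invertible and conjugates \<open>matrix g\<close> into
  \<open>matrix h\<close>, so the determinant is invariant by multiplicativity and the trace by
  cyclicity.\<close>

lemma similar_det_trace:
  fixes f :: "real^'n \<Rightarrow> real^'n"
  assumes f: "linear f" "bij f" and g: "linear g" and h: "linear h"
    and eq: "\<And>x. f (g x) = h (f x)"
  shows "det (matrix g) = det (matrix h)" "trace (matrix g) = trace (matrix h)"
proof -
  let ?F = "matrix f"
  have comm: "?F ** matrix g = matrix h ** ?F"
    using eq matrix_compose[OF g f(1)] matrix_compose[OF f(1) h] by (simp add: comp_def)
  have inv: "invertible ?F"
    using f by (simp add: invertible_eq_bij matrix_works)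
  then obtain G where G: "?F ** G = mat 1" "G ** ?F = mat 1"
    by (auto simp: invertible_def)
  have "det ?F \<noteq> 0"
    using inv by (simp add: invertible_det_nz)
  moreover have "det ?F * det (matrix g) = det ?F * det (matrix h)"
    using arg_cong[OF comm, of det] by (simp only: det_mul mult.commute)
  ultimately show "det (matrix g) = det (matrix h)"
    by (simp only: mult_cancel_left simp_thms)
  have "matrix h = ?F ** (matrix g ** G)"
    unfolding matrix_mul_assoc comm by (simp add: matrix_mul_assoc[symmetric] G(1))
  then have "trace (matrix h) = trace ((matrix g ** G) ** ?F)"
    by (simp only: trace_mul_sym[of ?F])
  also have "\<dots> = trace (matrix g)"
    by (simp add: matrix_mul_assoc[symmetric] G(2))
  finally show "trace (matrix g) = trace (matrix h)" ..
qed

lemma algebra_isomorphism_invariants: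
  fixes m n :: "real^'n \<Rightarrow> real^'n \<Rightarrow> real^'n"
  assumes f: "algebra_isomorphism m n f" and m: "bilinear m" and n: "bilinear n"
  shows "det (matrix (m x)) = det (matrix (n (f x)))"
    and "det (matrix (\<lambda>y. m y x)) = det (matrix (\<lambda>y. n y (f x)))"
    and "trace (matrix (\<lambda>y. m y x)) = trace (matrix (\<lambda>y. n y (f x)))"
proof -
  have lf: "linear f" "bij f" and hom: "\<And>x y. f (m x y) = n (f x) (f y)"
    using f by (auto simp: algebra_isomorphism_def)
  have lin: "linear (m x)" "linear (\<lambda>y. m y x)" "linear (n (f x))" "linear (\<lambda>y. n y (f x))"
    using m n unfolding bilinear_def by blast+
  show "det (matrix (m x)) = det (matrix (n (f x)))"
    by (rule similar_det_trace(1)[OF lf lin(1,3)]) (rule hom)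
  show "det (matrix (\<lambda>y. m y x)) = det (matrix (\<lambda>y. n y (f x)))"
    by (rule similar_det_trace(1)[OF lf lin(2,4)]) (rule hom)
  show "trace (matrix (\<lambda>y. m y x)) = trace (matrix (\<lambda>y. n y (f x)))"
    by (rule similar_det_trace(2)[OF lf lin(2,4)]) (rule hom)
qed

text \<open>Right multiplication by \<open>x\<close> has the matrix of the complex number
  \<open>c * (x$1 + x$2) + i * s * (x$1 - x$2)\<close>: its determinant is the squared modulus, its
  trace twice the real part.\<close>

lemma table_mult_det_trace:
  shows "det (matrix (table_mult c s x)) = - 2 * c * s * ((x$1)\<^sup>2 + (x$2)\<^sup>2)"
    and "det (matrix (\<lambda>y. table_mult c s y x)) = c\<^sup>2 * (x$1 + x$2)\<^sup>2 + s\<^sup>2 * (x$1 - x$2)\<^sup>2"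
    and "trace (matrix (\<lambda>y. table_mult c s y x)) = 2 * c * (x$1 + x$2)"
  by (simp_all add: det_2 trace_def sum_2 matrix_def table_mult_def e1_def e2_def axis_def
        algebra_simps power2_eq_square)

text \<open>Positivity of \<open>c\<close> and \<open>c'\<close> selects one of the two pairs that
  differ by the common sign.\<close>

lemma table_mult_isomorphic_imp_eq:
  assumes iso: "algebra_isomorphic (table_mult c s) (table_mult c' s')"
    and pos: "c > 0" "c' > 0" and s': "s' \<noteq> 0"
    and unit: "c\<^sup>2 + s\<^sup>2 = 1" "c'\<^sup>2 + s'\<^sup>2 = 1"
  shows "c = c' \<and> s = s'"
proof -
  obtain f where f: "algebra_isomorphism (table_mult c s) (table_mult c' s') f"
    using iso by (auto simp: algebra_isomorphic_def)
  \<comment> \<open>Right multiplication by \<open>v\<close> is the scalar \<open>2 * c\<close>.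
    Determinant and trace then force the imaginary part \<open>s' * q\<close> of right
    multiplication by \<open>f v\<close> to vanish.\<close>
  define v :: "real^2" where "v = vector [1, 1]"
  have v: "v$1 = 1" "v$2 = 1"
    by (simp_all add: v_def)
  note inv = algebra_isomorphism_invariants[OF f bilinear_table_mult bilinear_table_mult,
      of v, unfolded table_mult_det_trace v]
  define p q where "p = f v $ 1 + f v $ 2" and "q = f v $ 1 - f v $ 2"
  have tr: "c' * p = 2 * c"
    using inv(3) by (simp add: p_def)
  have "(c' * p)\<^sup>2 + s'\<^sup>2 * q\<^sup>2 = (2 * c)\<^sup>2"
    using inv(2) by (simp add: p_def q_def power_mult_distrib)
  then have q: "q = 0"
    using tr s' by simp
  define N where "N = (f v $ 1)\<^sup>2 + (f v $ 2)\<^sup>2"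
  have "p\<^sup>2 + q\<^sup>2 = 2 * N"
    by (simp add: p_def q_def N_def power2_eq_square algebra_simps)
  moreover have "c' * s' * N = 2 * c * s"
    using inv(1) unfolding N_def[symmetric] by (simp add: mult_ac)
  ultimately have "c' * s' * p\<^sup>2 = 4 * c * s"
    using q by (simp add: mult_ac)
  \<comment> \<open>The extra factor \<open>c'\<close> completes the square
    \<open>(c' * p)\<^sup>2\<close>, so that \<open>tr\<close> eliminates the unknown
    \<open>p\<close>.\<close>
  then have "c' * (c' * s' * p\<^sup>2) = c' * (4 * c * s)"
    by (rule arg_cong)
  then have "s' * (c' * p)\<^sup>2 = 4 * c * s * c'"
    by (simp only: power2_eq_square mult_ac)
  then have "(4 * c) * (s' * c) = (4 * c) * (s * c')"
    unfolding tr by (simp only: power2_eq_square mult_ac)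
  then have cross: "s' * c = s * c'"
    using pos(1) by simp
  \<comment> \<open>By \<open>cross\<close> the unit vectors \<open>(c, s)\<close> and
    \<open>(c', s')\<close> are parallel, so their first coordinates have equal squares.\<close>
  have "c\<^sup>2 = c\<^sup>2 * (c'\<^sup>2 + s'\<^sup>2)"
    by (simp only: unit(2) mult_1_right)
  also have "\<dots> = c\<^sup>2 * c'\<^sup>2 + (s' * c)\<^sup>2"
    by (simp only: power_mult_distrib distrib_left mult_ac)
  also have "\<dots> = c'\<^sup>2 * (c\<^sup>2 + s\<^sup>2)"
    unfolding cross by (simp only: power_mult_distrib distrib_left mult_ac)
  also have "\<dots> = c'\<^sup>2"
    by (simp only: unit(1) mult_1_right)
  finally have "c = c'"
    using pos by (simp add: power2_eq_iff_nonneg)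
  moreover from this have "s = s'"
    using cross pos(2) by (metis mult_cancel_right less_irrefl)
  ultimately show ?thesis ..
qed

lemma table_mult_uminus_isomorphic:
  "algebra_isomorphic (table_mult c s) (table_mult (- c) (- s))"
  unfolding algebra_isomorphic_def algebra_isomorphism_def
proof (intro exI conjI allI)
  show "linear (uminus :: real^2 \<Rightarrow> real^2)"
    by (simp add: linear_iff)
  show "bij (uminus :: real^2 \<Rightarrow> real^2)"
    by (simp add: bij_uminus)
  show "- table_mult c s x y = table_mult (- c) (- s) (- x) (- y)" for x y
    by (simp add: table_mult_def algebra_simps)
qed

theorem theorem2:
  shows "(\<forall>c::real. c \<in> {-1<..<1} - {0} \<longrightarrow> algebra_isomorphic (A_plus c) (A_minus (- c))) \<and>
    (\<forall>c1 c2::real. c1 \<in> {0<..<1} \<longrightarrow> c2 \<in> {0<..<1} \<longrightarrow> c1 \<noteq> c2 \<longrightarrow>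
      \<not> algebra_isomorphic (A_plus c1) (A_plus c2)) \<and>
    (\<forall>c1 c2::real. c1 \<in> {0<..<1} \<longrightarrow> c2 \<in> {0<..<1} \<longrightarrow> c1 \<noteq> c2 \<longrightarrow>
      \<not> algebra_isomorphic (A_minus c1) (A_minus c2)) \<and>
    (\<forall>c1 c2::real. c1 \<in> {0<..<1} \<longrightarrow> c2 \<in> {0<..<1} \<longrightarrow>
      \<not> algebra_isomorphic (A_plus c1) (A_minus c2))"
proof -
  have nz: "sqrt (1 - c\<^sup>2) > 0" and unit: "c\<^sup>2 + (sqrt (1 - c\<^sup>2))\<^sup>2 = 1"
    if "c \<in> {0<..<1}" for c :: real
  proof -
    have "c\<^sup>2 < 1"
      using that by (simp add: abs_square_less_1)
    then show "sqrt (1 - c\<^sup>2) > 0" "c\<^sup>2 + (sqrt (1 - c\<^sup>2))\<^sup>2 = 1"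
      by simp_all
  qed
  \<comment> \<open>The square root depends only on the square of \<open>c\<close>, so passing from
    \<open>A_plus c\<close> to \<open>A_minus (- c)\<close> negates both parameters.\<close>
  have "algebra_isomorphic (A_plus c) (A_minus (- c))" for c
    using table_mult_uminus_isomorphic by (simp add: A_plus_def A_minus_def)
  moreover have "c1 = c2" if "algebra_isomorphic (A_plus c1) (A_plus c2)"
    and "c1 \<in> {0<..<1}" "c2 \<in> {0<..<1}" for c1 c2
    using table_mult_isomorphic_imp_eq[OF that(1)[unfolded A_plus_def]] that(2,3)
      nz[OF that(3)] unit[OF that(2)] unit[OF that(3)] by simp
  moreover have "c1 = c2" if "algebra_isomorphic (A_minus c1) (A_minus c2)"
    and "c1 \<in> {0<..<1}" "c2 \<in> {0<..<1}" for c1 c2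
    using table_mult_isomorphic_imp_eq[OF that(1)[unfolded A_minus_def]] that(2,3)
      nz[OF that(3)] unit[OF that(2)] unit[OF that(3)] by simp
  \<comment> \<open>Here the second parameters would be equal, although one is positive and the
    other negative.\<close>
  moreover have False if "algebra_isomorphic (A_plus c1) (A_minus c2)"
    and "c1 \<in> {0<..<1}" "c2 \<in> {0<..<1}" for c1 c2
    using table_mult_isomorphic_imp_eq[OF that(1)[unfolded A_plus_def A_minus_def]] that(2,3)
      nz[OF that(2)] nz[OF that(3)] unit[OF that(2)] unit[OF that(3)] by simp
  ultimately show ?thesis
    by blast
qed

end
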